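(* Let $G$ be a graph on vertex set $\{1,\dots,n\}$, let $\phi$ be any automorphism of $G$, and let $M$ be an $n\times n$ automorphism compatible matrix of $G$. Then there exists an explicitly constructible invertible matrix $T$ and square matrices $B_1,\dots,B_K$ such that \[ T^{-1}MT=M_\phi\oplus B_1\oplus B_2\oplus\cdots\oplus B_K, \] where $M_\phi$ is the divisor matrix of $M$ associated with the partition of $V(G)$ into orbits of $\phi$. Consequently $\sigma(M)=\sigma(M_\phi)\cup\sigma(B_1)\cup\cdots\cup\sigma(B_K)$ (as multisets).
   Context: An automorphism of a graph $G$ is a bijection of $V(G)$ preserving adjacency (and edge weights, if weighted). An $n\times n$ matrix $M$ is automorphism compatible on $G$ if $M_{\psi(i),\psi(j)}=M_{i,j}$ for every automorphism $\psi$ of $G$ and all $i,j$. The orbits of $\phi$ are the classes $\{\phi^j(v):j\ge0\}$; if they are $V_1,\dots,V_k$, then $\sum_{t\in V_j}M_{s,t}$ is independent of $s\in V_i$, and the divisor matrix $M_\phi$ is the $k\times k$ matrix with $(i,j)$ entry this common value. $\sigma(X)$ is the multiset of eigenvalues of $X$; $\oplus$ is the block-diagonal direct sum. *)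

theory Defs
  imports
    "HOL-Computational_Algebra.Computational_Algebra"
    "Jordan_Normal_Form.Char_Poly"
    "Graph_Theory.Pair_Digraph"
begin

text \<open>
  Conventions.  Vertices are numbered from 0, as the rows and columns of a matrix are, so
  ``a graph on n vertices'' has vertex set \<open>{..<n}\<close>.  A graph is a set of arcs: it is undirected
  when \<open>parcs G\<close> is symmetric, and loops are allowed.  Edge weights are given by a function on arcs
  with values in an arbitrary type; an unweighted graph is one with a constant weight function.
\<close>

definition graph_automorphism ::
    "'v pair_pre_digraph \<Rightarrow> ('v \<times> 'v \<Rightarrow> 'w) \<Rightarrow> ('v \<Rightarrow> 'v) \<Rightarrow> bool" where
  "graph_automorphism G w \<psi> \<longleftrightarrow>
     bij_betw \<psi> (pverts G) (pverts G) \<and>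
     (\<forall>u\<in>pverts G. \<forall>v\<in>pverts G. (\<psi> u, \<psi> v) \<in> parcs G \<longleftrightarrow> (u, v) \<in> parcs G) \<and>
     (\<forall>(u, v)\<in>parcs G. w (\<psi> u, \<psi> v) = w (u, v))"

definition automorphism_compatible ::
    "nat pair_pre_digraph \<Rightarrow> (nat \<times> nat \<Rightarrow> 'w) \<Rightarrow> 'a mat \<Rightarrow> bool" where
  "automorphism_compatible G w M \<longleftrightarrow>
     (\<forall>\<psi>. graph_automorphism G w \<psi> \<longrightarrow>
        (\<forall>i\<in>pverts G. \<forall>j\<in>pverts G. M $$ (\<psi> i, \<psi> j) = M $$ (i, j)))"

definition vertex_orbit :: "('v \<Rightarrow> 'v) \<Rightarrow> 'v \<Rightarrow> 'v set" where
  "vertex_orbit \<phi> v = range (\<lambda>j. (\<phi> ^^ j) v)"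

definition orbit_enumeration :: "'v pair_pre_digraph \<Rightarrow> ('v \<Rightarrow> 'v) \<Rightarrow> 'v set list \<Rightarrow> bool" where
  "orbit_enumeration G \<phi> Vs \<longleftrightarrow> distinct Vs \<and> set Vs = vertex_orbit \<phi> ` pverts G"

text \<open>The description below is well defined by the lemma \<open>divisor_mat_index\<close>.\<close>

definition divisor_mat :: "'a :: comm_ring_1 mat \<Rightarrow> nat set list \<Rightarrow> 'a mat" where
  "divisor_mat M Vs = mat (length Vs) (length Vs)
     (\<lambda>(i, j). THE c. \<forall>s\<in>Vs ! i. (\<Sum>t\<in>Vs ! j. M $$ (s, t)) = c)"

definition eigenvalue_mset :: "complex mat \<Rightarrow> complex multiset" where
  "eigenvalue_mset A = proots (char_poly A)"

text \<open>
  An explicit transforming matrix, depending on \<open>\<phi>\<close> and the enumeration of its orbits only.  On an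
  orbit with m elements, starting at its least vertex r, the j-th Fourier mode has the value
  exp(2 \<pi> i j t / m) at the vertex \<open>(\<phi> ^^ t) r\<close>, and it vanishes on the other orbits.  The columns
  are these modes: first the modes j = 0, which are the indicator vectors of the orbits in the order
  of \<open>Vs\<close>, then the others, ordered so that modes of equal frequency j / m are adjacent.  (Modes of
  equal frequency span an eigenspace of the permutation \<open>\<phi>\<close>.)
\<close>

definition fourier_modes :: "nat set list \<Rightarrow> (nat \<times> nat) list" where
  "fourier_modes Vs =
     [(i, 0). i \<leftarrow> [0..<length Vs]] @
     sort_key (\<lambda>(i, j). real j / real (card (Vs ! i)))
       [(i, j). i \<leftarrow> [0..<length Vs], j \<leftarrow> [1..<card (Vs ! i)]]"

definition fourier_entry :: "(nat \<Rightarrow> nat) \<Rightarrow> nat set \<Rightarrow> nat \<Rightarrow> nat \<Rightarrow> complex" where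
  "fourier_entry \<phi> V j s =
     (if s \<in> V
      then cis (2 * pi * real j * real (LEAST t. (\<phi> ^^ t) (Min V) = s) / real (card V))
      else 0)"

definition orbit_fourier_mat :: "nat \<Rightarrow> (nat \<Rightarrow> nat) \<Rightarrow> nat set list \<Rightarrow> complex mat" where
  "orbit_fourier_mat n \<phi> Vs =
     mat n n (\<lambda>(s, c). case fourier_modes Vs ! c of (i, j) \<Rightarrow> fourier_entry \<phi> (Vs ! i) j s)"

lemma divisor_mat_index:
  fixes G :: "nat pair_pre_digraph" and w :: "nat \<times> nat \<Rightarrow> 'w" and M :: "'a :: comm_ring_1 mat"
  assumes fin: "finite (pverts G)" and aut: "graph_automorphism G w \<phi>"
    and comp: "automorphism_compatible G w M" and Vs: "orbit_enumeration G \<phi> Vs"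
    and i: "i < length Vs" and j: "j < length Vs" and s: "s \<in> Vs ! i"
  shows "divisor_mat M Vs $$ (i, j) = (\<Sum>t\<in>Vs ! j. M $$ (s, t))"
proof -
  let ?V = "Vs ! j"
  let ?f = "\<lambda>s. \<Sum>t\<in>?V. M $$ (s, t)"
  have bij: "bij_betw \<phi> (pverts G) (pverts G)"
    using aut by (simp add: graph_automorphism_def)
  have pow: "(\<phi> ^^ k) v \<in> pverts G" if "v \<in> pverts G" for k v
    using that bij by (induction k) (auto dest: bij_betwE)
  obtain u v where u: "u \<in> pverts G" "Vs ! i = vertex_orbit \<phi> u"
    and v: "v \<in> pverts G" "?V = vertex_orbit \<phi> v"
    using Vs nth_mem[OF i] nth_mem[OF j] unfolding orbit_enumeration_def by auto
  have Vsub: "?V \<subseteq> pverts G"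
    using v pow by (auto simp: vertex_orbit_def)
  have injV: "inj_on \<phi> ?V"
    using bij Vsub by (auto simp: bij_betw_def intro: inj_on_subset)
  have "\<phi> ` ?V \<subseteq> ?V"
  proof
    fix x assume "x \<in> \<phi> ` ?V"
    then obtain k where "x = (\<phi> ^^ Suc k) v" by (auto simp: v vertex_orbit_def)
    then show "x \<in> ?V" unfolding v vertex_orbit_def by blast
  qed
  then have imV: "\<phi> ` ?V = ?V"
    using injV finite_subset[OF Vsub fin] by (metis endo_inj_surj)
  have step: "?f (\<phi> x) = ?f x" if x: "x \<in> pverts G" for x
  proof -
    have "?f (\<phi> x) = (\<Sum>t\<in>?V. M $$ (\<phi> x, \<phi> t))"
      using sum.reindex[OF injV, of "\<lambda>t. M $$ (\<phi> x, t)"] imV by simp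
    also have "\<dots> = ?f x"
      using comp aut x Vsub unfolding automorphism_compatible_def
      by (intro sum.cong) blast+
    finally show ?thesis .
  qed
  have const: "?f ((\<phi> ^^ k) u) = ?f u" for k
    by (induction k) (auto simp: step pow u)
  have all: "?f x = ?f u" if "x \<in> Vs ! i" for x
    using that const unfolding u vertex_orbit_def by auto
  have "(THE c. \<forall>x\<in>Vs ! i. ?f x = c) = ?f s"
  proof (rule the_equality)
    show "\<forall>x\<in>Vs ! i. ?f x = ?f s" using all s by metis
  next
    fix c assume "\<forall>x\<in>Vs ! i. ?f x = c"
    then show "c = ?f s" using s by auto
  qed
  then show ?thesis using i j by (simp add: divisor_mat_def)
qed

end

theory Submission
  imports Defs
begin

text \<open>
  The Fourier modes are eigenvectors of the permutation \<open>\<phi>\<close>, with eigenvalues on the unit circle.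
  If a bilinear form is invariant under \<open>\<phi>\<close>, reindexing the double sum by \<open>\<phi>\<close> shows that its value
  at two modes (one of them conjugated) is multiplied by a unimodular number different from 1, hence
  vanishes, as soon as the modes have different frequencies.  Applied to the identity matrix this
  gives the orthogonality of the modes, so that the inverse of \<open>T\<close> is its rescaled adjoint; applied
  to \<open>M\<close> it makes the constant modes decouple from all others.  On the constant modes, the
  indicators of the orbits, \<open>M\<close> acts as the divisor matrix.  The other modes together give
  a single block (none if every orbit is a singleton).
\<close>

section \<open>Auxiliary facts on phases, matrix entries and characteristic polynomials\<close>

lemma cis_two_pi_inj:
  assumes "cis (2 * pi * x) = cis (2 * pi * y)" "0 \<le> x" "x < 1" "0 \<le> y" "y < 1"
  shows "x = y"
proof -
  have "sin (2 * pi * x) = sin (2 * pi * y) \<and> cos (2 * pi * x) = cos (2 * pi * y)"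
    using assms(1) by (simp add: complex_eq_iff)
  then obtain k :: int where "2 * pi * x = 2 * pi * y + 2 * pi * k"
    unfolding sin_cos_eq_iff by auto
  then have "2 * pi * x = 2 * pi * (y + k)" by (simp add: distrib_left)
  then have *: "x = y + k" by simp
  \<comment> \<open>The integer \<open>k\<close> equals \<open>x - y\<close>, which lies strictly
    between -1 and 1.\<close>
  then have "k = 0" using assms by linarith
  then show ?thesis using * by simp
qed

lemma mat_mult_index:
  assumes "A \<in> carrier_mat n m" "B \<in> carrier_mat m p" "i < n" "j < p"
  shows "(A * B) $$ (i, j) = (\<Sum>l<m. A $$ (i, l) * B $$ (l, j))"
  using assms by (auto simp: scalar_prod_def atLeast0LessThan intro!: sum.cong)

text \<open>The characteristic matrix is again block diagonal, so its determinant factors. Blocks of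
  size 0 are covered.\<close>

lemma char_poly_four_block_zeros:
  fixes A :: "'a :: idom mat"
  assumes A: "A \<in> carrier_mat k k" and B: "B \<in> carrier_mat m m"
  shows "char_poly (four_block_mat A (0\<^sub>m k m) (0\<^sub>m m k) B) = char_poly A * char_poly B"
proof -
  have "char_poly_matrix (four_block_mat A (0\<^sub>m k m) (0\<^sub>m m k) B) =
      four_block_mat (char_poly_matrix A) (0\<^sub>m k m) (0\<^sub>m m k) (char_poly_matrix B)"
    unfolding char_poly_matrix_def using A B by (intro eq_matI) (auto simp: one_poly_def)
  then show ?thesis
    unfolding char_poly_def
    using det_four_block_mat_lower_left_zero[of "char_poly_matrix A" k "0\<^sub>m k m" m "0\<^sub>m m k"
        "char_poly_matrix B"] A B
    by simp
qed

section \<open>Orbits of a permutation of a finite set\<close>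

lemma funpow_closed: "\<phi> ` A \<subseteq> A \<Longrightarrow> x \<in> A \<Longrightarrow> (\<phi> ^^ t) x \<in> A"
  by (induction t) auto

text \<open>Cancel the first \<open>a\<close> steps: \<open>\<phi> ^^ a\<close> is injective on
  \<open>A\<close>, and all iterates of \<open>x\<close> stay there.\<close>

lemma funpow_collision:
  assumes bij: "bij_betw \<phi> A A" and x: "x \<in> A" and ab: "a < b" "(\<phi> ^^ a) x = (\<phi> ^^ b) x"
  shows "(\<phi> ^^ (b - a)) x = x"
proof -
  have inj: "inj_on (\<phi> ^^ a) A"
    using bij_betw_funpow[OF bij] by (simp add: bij_betw_def)
  have "(\<phi> ^^ a) ((\<phi> ^^ (b - a)) x) = (\<phi> ^^ (a + (b - a))) x" by (simp only: funpow_add o_apply)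
  then have "(\<phi> ^^ a) ((\<phi> ^^ (b - a)) x) = (\<phi> ^^ a) x" using ab by simp
  moreover have "(\<phi> ^^ (b - a)) x \<in> A"
    using funpow_closed[of \<phi> A] bij x by (auto simp: bij_betw_def)
  ultimately show ?thesis using inj x by (auto dest: inj_onD)
qed

text \<open>Let \<open>p\<close> be the least positive return time of \<open>x\<close>, which exists
  by the pigeonhole principle. A collision before time \<open>p\<close> would give a shorter return,
  and exponents can be reduced modulo \<open>p\<close>; hence the orbit consists of \<open>p\<close>
  distinct iterates and \<open>m = p\<close>.\<close>

lemma vertex_orbit_cyclic:
  fixes \<phi> :: "'v \<Rightarrow> 'v"
  assumes fin: "finite A" and bij: "bij_betw \<phi> A A" and x: "x \<in> A"
  defines "m \<equiv> card (vertex_orbit \<phi> x)"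
  shows "m > 0" "(\<phi> ^^ m) x = x" "inj_on (\<lambda>t. (\<phi> ^^ t) x) {..<m}"
    "vertex_orbit \<phi> x = (\<lambda>t. (\<phi> ^^ t) x) ` {..<m}"
proof -
  let ?f = "\<lambda>t. (\<phi> ^^ t) x"
  have "range ?f \<subseteq> A"
    using funpow_closed[of \<phi> A] bij x by (auto simp: bij_betw_def)
  then have "\<not> inj ?f"
    using fin infinite_UNIV_nat finite_imageD finite_subset by metis
  then obtain a b where "a < b" "?f a = ?f b"
    unfolding inj_def by (metis linorder_neqE_nat)
  then have ex: "\<exists>p. 0 < p \<and> ?f p = x"
    using funpow_collision[OF bij x] by (metis zero_less_diff)
  define p where "p = (LEAST p. 0 < p \<and> ?f p = x)"
  have p: "0 < p" "?f p = x"
    using LeastI_ex[OF ex] by (auto simp: p_def)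
  have least: "p \<le> q" if "0 < q" "?f q = x" for q
    unfolding p_def using that by (auto intro: Least_le)
  have no: "\<not> (a < b \<and> b < p \<and> ?f a = ?f b)" for a b
    using funpow_collision[OF bij x, of a b] least[of "b - a"] by auto
  have inj: "inj_on ?f {..<p}"
    by (rule inj_onI) (metis lessThan_iff linorder_neqE_nat no)
  have im: "vertex_orbit \<phi> x = ?f ` {..<p}"
  proof -
    have "?f t \<in> ?f ` {..<p}" for t
      using funpow_mod_eq[OF p(2), of t] p(1) by (metis imageI lessThan_iff mod_less_divisor)
    then show ?thesis by (auto simp: vertex_orbit_def)
  qed
  have "m = p" using inj im by (simp add: m_def card_image)
  then show "m > 0" "(\<phi> ^^ m) x = x" "inj_on ?f {..<m}" "vertex_orbit \<phi> x = ?f ` {..<m}"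
    using p inj im by auto
qed

text \<open>Orbits use forward iterates only, but \<open>x\<close> is reached from \<open>y\<close>
  by completing the cycle with \<open>m - a\<close> more steps.\<close>

lemma vertex_orbit_eq:
  assumes fin: "finite A" and bij: "bij_betw \<phi> A A" and x: "x \<in> A" and y: "y \<in> vertex_orbit \<phi> x"
  shows "vertex_orbit \<phi> y = vertex_orbit \<phi> x"
proof -
  define m where "m = card (vertex_orbit \<phi> x)"
  note cyc = vertex_orbit_cyclic[OF fin bij x, folded m_def]
  obtain a where a: "a < m" "y = (\<phi> ^^ a) x" using y cyc(4) by auto
  have "(\<phi> ^^ (m - a)) y = (\<phi> ^^ (m - a + a)) x" by (simp only: funpow_add o_apply a)
  then have "(\<phi> ^^ (m - a)) y = x" using a cyc(2) by simp
  then have "(\<phi> ^^ t) x = (\<phi> ^^ (t + (m - a))) y" for t by (simp add: funpow_add)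
  moreover have "(\<phi> ^^ t) y = (\<phi> ^^ (t + a)) x" for t by (simp add: funpow_add a)
  ultimately show ?thesis unfolding vertex_orbit_def by (auto simp del: funpow.simps)
qed

text \<open>A mode is an eigenvector of \<open>\<phi>\<close>: one step along the cycle advances the
  phase by a fixed angle, and off \<open>V\<close> both sides vanish.\<close>

lemma fourier_entry_shift:
  assumes fin: "finite A" and bij: "bij_betw \<phi> A A" and V: "V \<in> vertex_orbit \<phi> ` A"
    and s: "s \<in> A"
  shows "fourier_entry \<phi> V j (\<phi> s) = cis (2 * pi * (real j / real (card V))) * fourier_entry \<phi> V j s"
proof -
  obtain u where u: "u \<in> A" "V = vertex_orbit \<phi> u" using V by auto
  have VA: "V \<subseteq> A"
    using funpow_closed[of \<phi> A] bij u by (auto simp: bij_betw_def vertex_orbit_def)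
  have "u \<in> V" unfolding u vertex_orbit_def by (rule range_eqI[of _ _ 0]) simp
  then have "Min V \<in> V" using VA fin finite_subset Min_in by blast
  then have r: "Min V \<in> A" "V = vertex_orbit \<phi> (Min V)"
    using VA vertex_orbit_eq[OF fin bij u(1)] u(2) by auto
  define r where "r = Min V"
  define m where "m = card V"
  have cyc: "0 < m" "(\<phi> ^^ m) r = r" "inj_on (\<lambda>t. (\<phi> ^^ t) r) {..<m}"
    "V = (\<lambda>t. (\<phi> ^^ t) r) ` {..<m}"
    using vertex_orbit_cyclic[OF fin bij r(1)] r(2) by (simp_all add: r_def m_def)
  \<comment> \<open>The \<open>LEAST\<close> in \<open>fourier_entry\<close> thus recovers the
    position on the cycle.\<close>
  have least: "(LEAST t. (\<phi> ^^ t) r = (\<phi> ^^ a) r) = a" if "a < m" for a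
  proof (rule Least_equality)
    fix b assume b: "(\<phi> ^^ b) r = (\<phi> ^^ a) r"
    show "a \<le> b"
    proof (rule ccontr)
      assume "\<not> a \<le> b"
      then show False using inj_onD[OF cyc(3) b] that by auto
    qed
  qed simp
  have entry: "fourier_entry \<phi> V j ((\<phi> ^^ a) r) = cis (2 * pi * real j * real a / real m)"
    if "a < m" for a
  proof -
    have "(\<phi> ^^ a) r \<in> V" by (subst cyc(4)) (simp add: that)
    then show ?thesis
      unfolding fourier_entry_def r_def[symmetric] m_def[symmetric] least[OF that] by simp
  qed
  show ?thesis
  proof (cases "s \<in> V")
    case True
    then obtain a where a: "a < m" "s = (\<phi> ^^ a) r" using cyc(4) by auto
    have phis: "\<phi> s = (\<phi> ^^ Suc a) r" by (simp add: a)
    have "fourier_entry \<phi> V j (\<phi> s) = cis (2 * pi * real j * real (Suc a) / real m)"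
    proof (cases "Suc a < m")
      case True
      then show ?thesis unfolding phis by (rule entry)
    next
      case False
      \<comment> \<open>Wrap-around: the step leads back to \<open>r\<close>, where the entry is 1,
        and the phase has completed \<open>j\<close> full turns.\<close>
      then have m: "Suc a = m" using a by simp
      have "\<phi> s = (\<phi> ^^ 0) r" unfolding phis m using cyc(2) by simp
      then have "fourier_entry \<phi> V j (\<phi> s) = 1" using entry[OF cyc(1)] by simp
      moreover have "2 * pi * real j * real (Suc a) / real m = 2 * pi * real j"
        unfolding m using cyc(1) by simp
      ultimately show ?thesis by simp
    qed
    also have "\<dots> = cis (2 * pi * (real j / real m)) * cis (2 * pi * real j * real a / real m)"
      unfolding cis_mult by (simp add: field_simps add_divide_distrib)
    finally show ?thesis using entry[OF a(1)] a(2) by (simp add: m_def)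
  next
    case False
    \<comment> \<open>\<open>s\<close> and \<open>\<phi> s\<close> have the same orbit, so
      \<open>\<phi> s\<close> in \<open>V\<close> would force \<open>s\<close> in
      \<open>V\<close>.\<close>
    have "\<phi> s \<notin> V"
    proof
      assume "\<phi> s \<in> V"
      then have "V = vertex_orbit \<phi> (\<phi> s)"
        using vertex_orbit_eq[OF fin bij u(1)] u(2) by simp
      moreover have "\<phi> s \<in> vertex_orbit \<phi> s"
        unfolding vertex_orbit_def by (rule range_eqI[of _ _ 1]) simp
      then have "vertex_orbit \<phi> (\<phi> s) = vertex_orbit \<phi> s"
        by (rule vertex_orbit_eq[OF fin bij s])
      moreover have "s \<in> vertex_orbit \<phi> s"
        unfolding vertex_orbit_def by (rule range_eqI[of _ _ 0]) simp
      ultimately show False using False by simp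
    qed
    then show ?thesis using False by (simp add: fourier_entry_def)
  qed
qed

section \<open>The Fourier basis\<close>

locale orbit_partition =
  fixes n :: nat and \<phi> :: "nat \<Rightarrow> nat" and Vs :: "nat set list"
  assumes bij: "bij_betw \<phi> {..<n} {..<n}"
    and distinct_Vs: "distinct Vs"
    and set_Vs: "set Vs = vertex_orbit \<phi> ` {..<n}"
begin

abbreviation k where "k \<equiv> length Vs"

text \<open>The eigenvalue of \<open>\<phi>\<close> on the mode \<open>p\<close> is
  \<open>cis (2 * pi * mode_freq p)\<close>.\<close>

definition mode_freq :: "nat \<times> nat \<Rightarrow> real" where
  "mode_freq p = real (snd p) / real (card (Vs ! fst p))"

definition mode_vec :: "nat \<times> nat \<Rightarrow> nat \<Rightarrow> complex" where
  "mode_vec p = fourier_entry \<phi> (Vs ! fst p) (snd p)"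

definition modes :: "(nat \<times> nat) set" where
  "modes = (SIGMA i:{..<k}. {..<card (Vs ! i)})"

section \<open>The orbits as a partition of the vertices\<close>

lemma block_orbit: "i < k \<Longrightarrow> Vs ! i \<in> vertex_orbit \<phi> ` {..<n}"
  using set_Vs nth_mem by blast

lemma block_subset: "i < k \<Longrightarrow> Vs ! i \<subseteq> {..<n}"
  using block_orbit[of i] funpow_closed[of \<phi> "{..<n}"] bij
  by (fastforce simp: bij_betw_def vertex_orbit_def)

lemma card_block_pos: "i < k \<Longrightarrow> card (Vs ! i) > 0"
  using block_orbit[of i] vertex_orbit_cyclic(1)[OF _ bij] by auto

text \<open>A block is the orbit of each of its points, so a common point would make two blocks
  equal.\<close>

lemma block_disjoint:
  assumes "i < k" "j < k" "i \<noteq> j"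
  shows "Vs ! i \<inter> Vs ! j = {}"
proof (rule ccontr)
  assume "Vs ! i \<inter> Vs ! j \<noteq> {}"
  then obtain x where "x \<in> Vs ! i" "x \<in> Vs ! j" by auto
  moreover have "vertex_orbit \<phi> x = Vs ! l" if "l < k" "x \<in> Vs ! l" for l
  proof -
    obtain u where "u < n" "Vs ! l = vertex_orbit \<phi> u" using block_orbit[OF \<open>l < k\<close>] by auto
    then show ?thesis using vertex_orbit_eq[OF _ bij, of u x] that by simp
  qed
  ultimately have "vertex_orbit \<phi> x = Vs ! i" "vertex_orbit \<phi> x = Vs ! j"
    using assms by auto
  then show False using assms distinct_Vs by (simp add: nth_eq_iff_index_eq)
qed

lemma union_blocks: "(\<Union>i<k. Vs ! i) = {..<n}"
proof -
  have "v \<in> vertex_orbit \<phi> v" for v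
    unfolding vertex_orbit_def by (rule range_eqI[of _ _ 0]) simp
  then have "{..<n} \<subseteq> \<Union> (set Vs)" unfolding set_Vs by blast
  then show ?thesis using block_subset by (fastforce simp: in_set_conv_nth)
qed

section \<open>Counting and ordering the modes\<close>

lemma card_modes: "card modes = n"
proof -
  have "card modes = (\<Sum>i<k. card (Vs ! i))" by (simp add: modes_def)
  also have "\<dots> = card (\<Union>i<k. Vs ! i)"
    by (rule card_UN_disjoint[symmetric])
      (use block_disjoint finite_subset[OF block_subset] in auto)
  finally show ?thesis by (simp add: union_blocks)
qed

lemma set_fourier_modes: "set (fourier_modes Vs) = modes"
proof (rule Set.set_eqI)
  fix p :: "nat \<times> nat"
  obtain i j where p: "p = (i, j)" by force
  show "p \<in> set (fourier_modes Vs) \<longleftrightarrow> p \<in> modes"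
    using card_block_pos[of i]
    by (cases "j = 0") (auto simp: p fourier_modes_def modes_def image_iff Bex_def)
qed

lemma length_fourier_modes: "length (fourier_modes Vs) = n"
proof -
  have eq: "length (fourier_modes Vs) = k + (\<Sum>i\<leftarrow>[0..<k]. card (Vs ! i) - 1)"
    by (simp add: fourier_modes_def length_concat o_def)
  have "(\<Sum>i\<leftarrow>[0..<k]. card (Vs ! i) - 1) = (\<Sum>i<k. card (Vs ! i) - 1)"
    by (simp add: interv_sum_list_conv_sum_set_nat atLeast0LessThan)
  \<comment> \<open>Blocks are nonempty, so the natural number subtraction does not
    truncate.\<close>
  moreover have "(\<Sum>i<k. card (Vs ! i)) = (\<Sum>i<k. 1 + (card (Vs ! i) - 1))"
    using card_block_pos by (intro sum.cong) auto
  moreover have "\<dots> = k + (\<Sum>i<k. card (Vs ! i) - 1)" by (simp only: sum.distrib) simp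
  moreover have "card modes = (\<Sum>i<k. card (Vs ! i))" by (simp add: modes_def)
  ultimately show ?thesis using eq card_modes by simp
qed

text \<open>The list has as many entries as its set has elements.\<close>

lemma distinct_fourier_modes: "distinct (fourier_modes Vs)"
  using set_fourier_modes length_fourier_modes card_modes by (metis card_distinct)

lemma fourier_modes_low: "c < k \<Longrightarrow> fourier_modes Vs ! c = (c, 0)"
  by (simp add: fourier_modes_def nth_append o_def)

text \<open>From position \<open>k\<close> on the list is the sorted one, built from
  \<open>j\<close> at least 1. So column \<open>k\<close> is where the matrix is cut into
  blocks.\<close>

lemma fourier_modes_high:
  assumes "k \<le> c" "c < n"
  shows "snd (fourier_modes Vs ! c) \<noteq> 0"
proof -
  let ?L = "sort_key (\<lambda>(i, j). real j / real (card (Vs ! i)))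
       [(i, j). i \<leftarrow> [0..<k], j \<leftarrow> [1..<card (Vs ! i)]]"
  have split: "fourier_modes Vs = map (\<lambda>i. (i, 0)) [0..<k] @ ?L"
    by (simp add: fourier_modes_def)
  have "c - k < length ?L"
    using length_fourier_modes assms unfolding split by simp
  then have "?L ! (c - k) \<in> set ?L" by (rule nth_mem)
  moreover have "fourier_modes Vs ! c = ?L ! (c - k)"
    unfolding split using assms by (simp add: nth_append)
  ultimately show ?thesis by (auto split: prod.splits)
qed

lemma fourier_modes_in: "c < n \<Longrightarrow> fourier_modes Vs ! c \<in> modes"
  using set_fourier_modes length_fourier_modes nth_mem by metis

lemma length_Vs_le: "k \<le> n"
  using length_fourier_modes unfolding fourier_modes_def by auto

lemma mode_freq_range: "p \<in> modes \<Longrightarrow> 0 \<le> mode_freq p \<and> mode_freq p < 1"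
  by (auto simp: modes_def mode_freq_def)

section \<open>Orthogonality of modes of different frequency\<close>

text \<open>Schur orthogonality for the cyclic group generated by \<open>\<phi>\<close>. The form
  \<open>A\<close> is left general to serve both for the identity and for \<open>M\<close>.\<close>

lemma invariant_form_vanishes:
  fixes A :: "nat \<Rightarrow> nat \<Rightarrow> complex"
  assumes inv: "\<And>s t. s < n \<Longrightarrow> t < n \<Longrightarrow> A (\<phi> s) (\<phi> t) = A s t"
    and pq: "p \<in> modes" "q \<in> modes" and ne: "mode_freq p \<noteq> mode_freq q"
  shows "(\<Sum>s<n. \<Sum>t<n. cnj (mode_vec p s) * A s t * mode_vec q t) = 0" (is "?S = 0")
proof -
  define a b where "a = cis (2 * pi * mode_freq p)" and "b = cis (2 * pi * mode_freq q)"
  have shift: "mode_vec p (\<phi> s) = a * mode_vec p s" "mode_vec q (\<phi> s) = b * mode_vec q s"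
    if "s < n" for s
    using fourier_entry_shift[OF _ bij block_orbit] that pq
    by (auto simp: mode_vec_def mode_freq_def modes_def a_def b_def)
  have re: "(\<Sum>s<n. f (\<phi> s)) = (\<Sum>s<n. f s)" for f :: "nat \<Rightarrow> complex"
    by (rule sum.reindex_bij_betw[OF bij])
  have "?S = (\<Sum>s<n. \<Sum>t<n. cnj (mode_vec p (\<phi> s)) * A (\<phi> s) (\<phi> t) * mode_vec q (\<phi> t))"
    using re[of "\<lambda>s. \<Sum>t<n. cnj (mode_vec p s) * A s t * mode_vec q t"]
    by (simp only: re[of "\<lambda>t. cnj (mode_vec p _) * A _ t * mode_vec q t"])
  also have "\<dots> = (\<Sum>s<n. \<Sum>t<n. (cnj a * b) * (cnj (mode_vec p s) * A s t * mode_vec q t))"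
    by (intro sum.cong) (simp_all add: shift inv mult_ac)
  also have "\<dots> = cnj a * b * ?S" by (simp only: sum_distrib_left)
  finally have "(1 - cnj a * b) * ?S = 0" by (simp add: algebra_simps)
  \<comment> \<open>As \<open>a\<close> is unimodular, equality would give \<open>a = b\<close>,
    hence equal frequencies.\<close>
  moreover have "cnj a * b \<noteq> 1"
  proof
    assume "cnj a * b = 1"
    then have "a * (cnj a * b) = a" by simp
    moreover have "a * cnj a = 1" by (simp add: a_def cis_cnj cis_mult)
    ultimately have "b = a" by (simp flip: mult.assoc)
    then show False
      using cis_two_pi_inj[of "mode_freq q" "mode_freq p"] mode_freq_range pq ne
      by (auto simp: a_def b_def)
  qed
  ultimately show ?thesis by simp
qed

lemma mode_vec_support: "p \<in> modes \<Longrightarrow> s \<notin> Vs ! fst p \<Longrightarrow> mode_vec p s = 0"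
  by (simp add: mode_vec_def fourier_entry_def)

lemma mode_vec_constant: "mode_vec (i, 0) s = (if s \<in> Vs ! i then 1 else 0)"
  by (simp add: mode_vec_def fourier_entry_def)

text \<open>Modes on different orbits may share a frequency, but their supports are disjoint.
  Distinct modes on one orbit differ in frequency. For \<open>p = q\<close> the entries on the orbit
  are unimodular.\<close>

lemma mode_vec_orthogonal:
  assumes pq: "p \<in> modes" "q \<in> modes"
  shows "(\<Sum>s<n. cnj (mode_vec p s) * mode_vec q s) =
    (if p = q then of_nat (card (Vs ! fst p)) else 0)"
proof -
  consider "p = q" | "fst p \<noteq> fst q" | "fst p = fst q" "snd p \<noteq> snd q"
    by (metis prod.expand)
  then show ?thesis
  proof cases
    case 1
    have sub: "Vs ! fst p \<subseteq> {..<n}"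
      using block_subset[of "fst p"] pq by (cases p) (simp add: modes_def)
    have "(\<Sum>s<n. cnj (mode_vec p s) * mode_vec p s) = (\<Sum>s<n. if s \<in> Vs ! fst p then 1 else 0)"
      by (intro sum.cong) (auto simp: mode_vec_def fourier_entry_def cis_cnj cis_mult)
    also have "\<dots> = of_nat (card (Vs ! fst p))"
      using sub by (simp add: sum.If_cases Int_absorb1)
    finally show ?thesis using 1 by simp
  next
    case 2
    then have "Vs ! fst p \<inter> Vs ! fst q = {}"
      using block_disjoint[of "fst p" "fst q"] pq by (cases p; cases q) (simp add: modes_def)
    then have "cnj (mode_vec p s) * mode_vec q s = 0" for s
      using mode_vec_support[OF pq(1), of s] mode_vec_support[OF pq(2), of s] by auto
    then show ?thesis using 2 by (auto simp: sum.neutral)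
  next
    case 3
    have ne: "mode_freq p \<noteq> mode_freq q"
      using 3 card_block_pos[of "fst p"] pq by (auto simp: mode_freq_def modes_def)
    have inj: "\<phi> s = \<phi> t \<longleftrightarrow> s = t" if "s < n" "t < n" for s t
      using bij that by (auto simp: bij_betw_def inj_on_eq_iff)
    \<comment> \<open>The Kronecker delta is an invariant form because \<open>\<phi>\<close> is
      injective on the vertices.\<close>
    have "(\<Sum>s<n. \<Sum>t<n. cnj (mode_vec p s) * (if s = t then 1 else 0) * mode_vec q t) = 0"
      by (rule invariant_form_vanishes[OF _ pq ne]) (simp add: inj)
    moreover have "(\<Sum>t<n. cnj (mode_vec p s) * (if s = t then 1 else 0) * mode_vec q t) =
        cnj (mode_vec p s) * mode_vec q s" if "s < n" for s
      using that by (simp add: if_distrib[of "\<lambda>x. _ * x * _"] if_distrib[of "\<lambda>x. x * _"] cong: if_cong)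
    ultimately have "(\<Sum>s<n. cnj (mode_vec p s) * mode_vec q s) = 0" by simp
    then show ?thesis using 3 by auto
  qed
qed

section \<open>The transforming matrix and its inverse\<close>

text \<open>The conjugate transpose of \<open>T\<close>, each row divided by the squared norm of the
  corresponding column of \<open>T\<close>.\<close>

definition adjoint_mat :: "complex mat" where
  "adjoint_mat = mat n n (\<lambda>(c, s). let p = fourier_modes Vs ! c in
     cnj (mode_vec p s) / of_nat (card (Vs ! fst p)))"

abbreviation T where "T \<equiv> orbit_fourier_mat n \<phi> Vs"

lemma T_carrier [simp]: "T \<in> carrier_mat n n"
  and adjoint_carrier [simp]: "adjoint_mat \<in> carrier_mat n n"
  by (simp_all add: orbit_fourier_mat_def adjoint_mat_def)

lemma T_index: "s < n \<Longrightarrow> c < n \<Longrightarrow> T $$ (s, c) = mode_vec (fourier_modes Vs ! c) s"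
  by (simp add: orbit_fourier_mat_def mode_vec_def case_prod_beta)

lemma adjoint_index:
  "c < n \<Longrightarrow> s < n \<Longrightarrow> adjoint_mat $$ (c, s) =
     cnj (mode_vec (fourier_modes Vs ! c) s) / of_nat (card (Vs ! fst (fourier_modes Vs ! c)))"
  by (simp add: adjoint_mat_def Let_def)

lemma adjoint_T: "adjoint_mat * T = 1\<^sub>m n"
proof (rule eq_matI)
  fix c d assume "c < dim_row (1\<^sub>m n :: complex mat)" "d < dim_col (1\<^sub>m n :: complex mat)"
  then have cd: "c < n" "d < n" by auto
  let ?p = "fourier_modes Vs ! c" and ?q = "fourier_modes Vs ! d"
  have "(adjoint_mat * T) $$ (c, d) =
      (\<Sum>s<n. cnj (mode_vec ?p s) * mode_vec ?q s) / of_nat (card (Vs ! fst ?p))"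
    using cd by (simp add: mat_mult_index[OF adjoint_carrier T_carrier] T_index adjoint_index
        sum_divide_distrib del: index_mult_mat)
  also have "\<dots> = (if ?p = ?q then 1 else 0)"
    using mode_vec_orthogonal fourier_modes_in[OF cd(1)] fourier_modes_in[OF cd(2)]
      card_block_pos[of "fst ?p"]
    by (auto simp: modes_def)
  \<comment> \<open>Distinctness of the list turns equality of modes into equality of
    indices.\<close>
  also have "\<dots> = 1\<^sub>m n $$ (c, d)"
    using cd distinct_fourier_modes length_fourier_modes by (simp add: nth_eq_iff_index_eq)
  finally show "(adjoint_mat * T) $$ (c, d) = 1\<^sub>m n $$ (c, d)" .
qed (simp_all add: adjoint_mat_def orbit_fourier_mat_def)

lemma T_adjoint: "T * adjoint_mat = 1\<^sub>m n"
  by (rule mat_mult_left_right_inverse[OF adjoint_carrier T_carrier adjoint_T])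

text \<open>Puts the entries of the transformed matrix into the form to which
  \<open>invariant_form_vanishes\<close> applies.\<close>

lemma conjugate_index:
  assumes M: "M \<in> carrier_mat n n" and cd: "c < n" "d < n"
  shows "(adjoint_mat * M * T) $$ (c, d) =
    (\<Sum>s<n. \<Sum>t<n. cnj (mode_vec (fourier_modes Vs ! c) s) * M $$ (s, t) *
        mode_vec (fourier_modes Vs ! d) t) / of_nat (card (Vs ! fst (fourier_modes Vs ! c)))"
proof -
  have "(adjoint_mat * M * T) $$ (c, d) =
      (\<Sum>t<n. \<Sum>s<n. adjoint_mat $$ (c, s) * M $$ (s, t) * T $$ (t, d))"
    using cd
    by (simp add: mat_mult_index[OF mult_carrier_mat[OF adjoint_carrier M] T_carrier]
        mat_mult_index[OF adjoint_carrier M] sum_distrib_right del: index_mult_mat)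
  also have "\<dots> = (\<Sum>s<n. \<Sum>t<n. adjoint_mat $$ (c, s) * M $$ (s, t) * T $$ (t, d))"
    by (rule sum.swap)
  finally show ?thesis
    using cd by (simp add: T_index adjoint_index sum_divide_distrib)
qed

end

section \<open>Block decomposition and spectrum\<close>

theorem theorem4p3:
  fixes G :: "nat pair_pre_digraph" and w :: "nat \<times> nat \<Rightarrow> 'w"
    and n :: nat and \<phi> :: "nat \<Rightarrow> nat" and M :: "complex mat" and Vs :: "nat set list"
  assumes "pair_wf_digraph G" and "pverts G = {..<n}"
    and "graph_automorphism G w \<phi>"
    and "M \<in> carrier_mat n n" and "automorphism_compatible G w M"
    and "orbit_enumeration G \<phi> Vs"
  shows "\<exists>(T :: complex mat) (Tinv :: complex mat) (Bs :: complex mat list).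
      T = orbit_fourier_mat n \<phi> Vs \<and>
      T \<in> carrier_mat n n \<and> Tinv \<in> carrier_mat n n \<and>
      inverts_mat T Tinv \<and> inverts_mat Tinv T \<and>
      (\<forall>B\<in>set Bs. square_mat B \<and> dim_row B > 0) \<and>
      Tinv * M * T = diag_block_mat (divisor_mat M Vs # Bs) \<and>
      eigenvalue_mset M =
        eigenvalue_mset (divisor_mat M Vs) + (\<Sum>B\<leftarrow>Bs. eigenvalue_mset B)"
proof -
  have bij: "bij_betw \<phi> {..<n} {..<n}"
    using assms(2,3) by (simp add: graph_automorphism_def)
  interpret orbit_partition n \<phi> Vs
    using bij assms(2,6) by unfold_locales (auto simp: orbit_enumeration_def)
  have M: "M \<in> carrier_mat n n" by (rule assms(4))
  have inv: "M $$ (\<phi> s, \<phi> t) = M $$ (s, t)" if "s < n" "t < n" for s t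
    using assms(2,3,5) that by (auto simp: automorphism_compatible_def)
  define D where "D = divisor_mat M Vs"
  define C where "C = adjoint_mat * M * T"
  define B where "B = mat (n - k) (n - k) (\<lambda>(c, d). C $$ (c + k, d + k))"
  \<comment> \<open>For \<open>k = n\<close> the list is empty, since listed blocks must have
    positive size.\<close>
  define Bs where "Bs = (if k < n then [B] else [])"
  have C: "C \<in> carrier_mat n n" unfolding C_def
    by (intro mult_carrier_mat[OF mult_carrier_mat[OF adjoint_carrier M] T_carrier])
  have D: "D \<in> carrier_mat k k" by (simp add: D_def divisor_mat_def)
  have B: "B \<in> carrier_mat (n - k) (n - k)" by (simp add: B_def)
  \<comment> \<open>Frequency 0 occurs exactly in the first \<open>k\<close> columns, so entries of
    the off-diagonal blocks pair different frequencies.\<close>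
  have decoupled: "C $$ (c, d) = 0" if cd: "c < n" "d < n" and ne: "c < k \<longleftrightarrow> \<not> d < k" for c d
  proof -
    have low: "mode_freq (fourier_modes Vs ! x) = 0" if "x < k" for x
      using that by (simp add: fourier_modes_low mode_freq_def)
    have high: "mode_freq (fourier_modes Vs ! x) \<noteq> 0" if "x < n" "\<not> x < k" for x
      using that fourier_modes_high[of x] fourier_modes_in[of x]
        card_block_pos[of "fst (fourier_modes Vs ! x)"]
      by (auto simp: mode_freq_def modes_def)
    have "mode_freq (fourier_modes Vs ! c) \<noteq> mode_freq (fourier_modes Vs ! d)"
      using low high cd ne by metis
    then show ?thesis
      using invariant_form_vanishes[of "\<lambda>s t. M $$ (s, t)"] inv fourier_modes_in cd
      by (simp add: C_def conjugate_index[OF M])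
  qed
  \<comment> \<open>Pairing two orbit indicators sums \<open>M\<close> over a block whose row sums
    all equal \<open>D $$ (c, d)\<close>; the normalization cancels the number of rows.\<close>
  have divisor: "C $$ (c, d) = D $$ (c, d)" if cd: "c < k" "d < k" for c d
  proof -
    have sub: "Vs ! c \<subseteq> {..<n}" "Vs ! d \<subseteq> {..<n}" using block_subset cd by auto
    have D_eq: "(\<Sum>t\<in>Vs ! d. M $$ (s, t)) = D $$ (c, d)" if "s \<in> Vs ! c" for s
      using divisor_mat_index[OF _ assms(3,5,6) cd that] assms(2) by (simp add: D_def)
    have "(\<Sum>s<n. \<Sum>t<n. cnj (mode_vec (c, 0) s) * M $$ (s, t) * mode_vec (d, 0) t) =
        (\<Sum>s<n. if s \<in> Vs ! c then \<Sum>t<n. if t \<in> Vs ! d then M $$ (s, t) else 0 else 0)"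
      by (intro sum.cong) (auto simp: mode_vec_constant intro!: sum.cong)
    also have "\<dots> = (\<Sum>s\<in>Vs ! c. \<Sum>t\<in>Vs ! d. M $$ (s, t))"
      using sub by (simp add: sum.If_cases Int_absorb1)
    also have "\<dots> = of_nat (card (Vs ! c)) * D $$ (c, d)" by (simp add: D_eq)
    finally show ?thesis
      using cd length_Vs_le card_block_pos[of c]
      by (simp add: C_def conjugate_index[OF M] fourier_modes_low)
  qed
  have block: "C = four_block_mat D (0\<^sub>m k (n - k)) (0\<^sub>m (n - k) k) B"
    using C D B length_Vs_le by (intro eq_matI) (auto simp: divisor decoupled B_def)
  \<comment> \<open>If \<open>Bs\<close> is empty, both sides are the 0 by 0 matrix.\<close>
  have diag: "diag_block_mat Bs = B"
    using B by (auto simp: Bs_def Let_def)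
  have blocks: "C = diag_block_mat (D # Bs)"
    using block D B by (simp add: diag)
  have "similar_mat C M"
    unfolding similar_mat_def C_def
    by (rule exI[of _ adjoint_mat], rule exI[of _ T], rule similar_mat_witI[of _ _ n])
      (use M T_adjoint adjoint_T C[unfolded C_def] in auto)
  then have "char_poly M = char_poly D * char_poly B"
    using char_poly_similar char_poly_four_block_zeros[OF D B] block by metis
  \<comment> \<open>Root multisets add under products of nonzero polynomials.\<close>
  moreover have "char_poly D \<noteq> 0" "char_poly B \<noteq> 0"
    using degree_monic_char_poly[OF D] degree_monic_char_poly[OF B] by auto
  ultimately have "eigenvalue_mset M = eigenvalue_mset D + eigenvalue_mset B"
    by (simp add: eigenvalue_mset_def proots_mult)
  \<comment> \<open>An empty \<open>B\<close> has a constant characteristic polynomial and so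
    contributes no eigenvalue.\<close>
  moreover have "eigenvalue_mset B = (\<Sum>B\<leftarrow>Bs. eigenvalue_mset B)"
  proof (cases "k < n")
    case False
    then have "B \<in> carrier_mat 0 0" using B by simp
    then show ?thesis
      using False degree_monic_char_poly[of B 0]
      by (auto simp: Bs_def eigenvalue_mset_def elim!: degree_eq_zeroE)
  qed (simp add: Bs_def)
  ultimately have "eigenvalue_mset M =
      eigenvalue_mset (divisor_mat M Vs) + (\<Sum>B\<leftarrow>Bs. eigenvalue_mset B)"
    by (simp only: D_def)
  moreover have "adjoint_mat * M * T = diag_block_mat (divisor_mat M Vs # Bs)"
    using blocks by (simp only: C_def D_def)
  moreover have "inverts_mat T adjoint_mat" "inverts_mat adjoint_mat T"
    unfolding inverts_mat_def
    by (simp_all only: T_adjoint adjoint_T carrier_matD[OF T_carrier]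
        carrier_matD[OF adjoint_carrier])
  moreover have "\<forall>B\<in>set Bs. square_mat B \<and> dim_row B > 0"
    using B by (auto simp: Bs_def)
  ultimately show ?thesis using T_carrier adjoint_carrier by blast
qed

end
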